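(* Let $\tau$ with $\operatorname{Im}\tau>0$ be fixed, let $u_1,u_2,u_3$ be the complex moduli of three branes $\mathcal{L}_1,\mathcal{L}_2,\mathcal{L}_3$ of pairwise different homology classes, and let $(i,j,k)$ be any permutation of $(1,2,3)$. Then for all $a,\bar b\in\{1,2,3\}$ $$\sum_{c=1}^3\Big(\partial_{u_k}\mathcal{T}^{(i\,j\,k\,j)}_{a\,c\,\bar c\,\bar b}-\partial_{u_k}\mathcal{T}^{(k\,i\,j\,i)}_{c\,a\,\bar b\,\bar c}\Big)=0 .$$ Consequently, suppose that the annulus correlators $\mathcal{A}^{(ii|kk)}_{\Omega|\Omega}=\mathcal{A}^{(kk|ii)}_{\Omega|\Omega}$, for $i\ne k$ in $\{1,2,3\}$, are functions of $(\tau,u_i,u_k)$ satisfying, for every permutation $(i,j,k)$ of $(1,2,3)$ and all $a,\bar b$, the quantum $A_\infty$ relation $$\delta_{a\bar b}\Big(\mathcal{A}^{(ii|kk)}_{\Omega|\Omega}-\mathcal{A}^{(jj|kk)}_{\Omega|\Omega}\Big)=\frac{1}{6\pi i}\sum_{c=1}^3\Big(\partial_{u_k}\mathcal{T}^{(i\,j\,k\,j)}_{a\,c\,\bar c\,\bar b}-\partial_{u_k}\mathcal{T}^{(k\,i\,j\,i)}_{c\,a\,\bar b\,\bar c}\Big).$$ Then there is a function $f_{\mathcal{A}}(\tau)$, independent of $u_1,u_2,u_3$, with $$\mathcal{A}^{(11|22)}_{\Omega|\Omega}=\mathcal{A}^{(22|33)}_{\Omega|\Omega}=\mathcal{A}^{(33|11)}_{\Omega|\Omega}=\frac{1}{(6\pi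 i)^2}f_{\mathcal{A}}(\tau).$$
   Context: Write $q=e^{2\pi i\tau}$. For $x\in\frac12\mathbb{Z}$, $[x]_3$ is the representative of $x$ modulo $3$ in $(0,3]$ (so in $\{1,2,3\}$ for integer $x$ and in $\{\frac12,\frac32,\frac52\}$ for half-odd $x$); $\delta^{(3)}_{x,y}$ is $1$ if $x\equiv y$ mod $3$ and $0$ otherwise. Boundary field labels take values in $\{1,2,3\}$; a bar on a label only marks the field type, so $\bar c=c$ numerically. The trapezoid correlators are $$\mathcal{T}^{(p_4p_1p_2p_3)}_{ab\bar c\bar d}=\delta^{(3)}_{a+b,\bar c+\bar d}\;\Theta_{trap}\!\left[{[b-\bar c]_3\atop [\bar d-\bar c+3/2]_3}\right]\big(3\tau\,|\,3(u_{p_1}+u_{p_2}+u_{p_4}),\,3(u_{p_1}-u_{p_3})\big),$$ $$\Theta_{trap}\!\left[{a\atop b}\right](3\tau|3u,3v)=e^{2\pi i v b}\sum_{n\in\mathbb{Z}}\frac{q^{\frac16(a+3n)(a+2b+3n)}\,e^{2\pi i(a+3n)(u-1/6)}}{1-q^{a+3n}e^{6\pi i v}}.$$ When $p_1=p_3$ (so the second argument is $v=0$) and $[b-\bar c]_3=3$, the $n=-1$ term is singular but independent of $u$; the $u_k$-derivative of the correlator is then defined as the limit $v\to0$ of the $u_k$-derivative of the function with $v\neq0$ (that is, the $u$-independent singular term is dropped). $\Omega$ denotes the marginal boundary-preserving operator; an insertion of $\Omega$ on brane $\mathcal{L}_k$ corresponds to $\frac1{6\pi i}\partial_{u_k}$.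 *)

theory Defs
  imports "HOL-Analysis.Analysis"
begin

text \<open>Representative in \<open>(0,3]\<close> of a real number modulo 3 (used for integers and half-odd numbers).\<close>

definition rep3 :: "real \<Rightarrow> real" where
  "rep3 x = x - 3 * of_int (\<lceil>x / 3\<rceil> - 1)"

lemma rep3_eq_iff:
  "rep3 x = r \<longleftrightarrow> 0 < r \<and> r \<le> 3 \<and> (\<exists>m::int. x - r = 3 * of_int m)"
proof
  assume "rep3 x = r"
  then show "0 < r \<and> r \<le> 3 \<and> (\<exists>m::int. x - r = 3 * of_int m)"
    unfolding rep3_def
    by (intro conjI exI[of _ "\<lceil>x / 3\<rceil> - 1"]) (linarith | simp)+
next
  assume *: "0 < r \<and> r \<le> 3 \<and> (\<exists>m::int. x - r = 3 * of_int m)"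
  then obtain m :: int where m: "x - r = 3 * of_int m" by blast
  have "\<lceil>x / 3\<rceil> = m + 1"
    by (rule ceiling_unique) (use * m in \<open>simp_all add: field_simps\<close>)
  then show "rep3 x = r" using m by (simp add: rep3_def)
qed

definition delta3 :: "int \<Rightarrow> int \<Rightarrow> complex" where
  "delta3 x y = (if x mod 3 = y mod 3 then 1 else 0)"

text \<open>The real powers \<open>q\<^sup>s\<close> of \<open>q = exp (2\<pi>i\<tau>)\<close> are fixed through the chosen \<open>\<tau>\<close>.\<close>

definition qpow :: "complex \<Rightarrow> real \<Rightarrow> complex" where
  "qpow \<tau> s = exp (2 * of_real pi * \<i> * \<tau> * of_real s)"

text \<open>
  The arguments of \<open>Theta_trap\<close> are the rescaled ones, i.e. \<open>Theta_trap a b (3\<tau>) (3u) (3v)\<close> is the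
  series written in terms of \<open>\<tau>\<close>, \<open>u\<close>, \<open>v\<close>. It converges absolutely if \<open>Im \<tau> > 0\<close> and no
  denominator vanishes.
\<close>

definition Theta_trap :: "real \<Rightarrow> real \<Rightarrow> complex \<Rightarrow> complex \<Rightarrow> complex \<Rightarrow> complex" where
  "Theta_trap a b T U V =
    (let \<tau> = T / 3; u = U / 3; v = V / 3 in
      exp (2 * of_real pi * \<i> * v * of_real b) *
      (\<Sum>\<^sub>\<infinity>n\<in>(UNIV :: int set).
         qpow \<tau> (1/6 * (a + 3 * of_int n) * (a + 2 * b + 3 * of_int n)) *
         exp (2 * of_real pi * \<i> * of_real (a + 3 * of_int n) * (u - 1/6)) /
         (1 - qpow \<tau> (a + 3 * of_int n) * exp (6 * of_real pi * \<i> * v))))"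

text \<open>
  The correlator as a function of independent arguments \<open>u\<close>, \<open>v\<close>; the actual one has
  \<open>u = u\<^bsub>p\<^sub>1\<^esub> + u\<^bsub>p\<^sub>2\<^esub> + u\<^bsub>p\<^sub>4\<^esub>\<close> and \<open>v = u\<^bsub>p\<^sub>1\<^esub> - u\<^bsub>p\<^sub>3\<^esub>\<close>.
\<close>

definition trap_fun :: "complex \<Rightarrow> int \<Rightarrow> int \<Rightarrow> int \<Rightarrow> int \<Rightarrow> complex \<Rightarrow> complex \<Rightarrow> complex" where
  "trap_fun \<tau> a b c d u v =
     delta3 (a + b) (c + d) *
     Theta_trap (rep3 (of_int (b - c))) (rep3 (of_int (d - c) + 3/2)) (3 * \<tau>) (3 * u) (3 * v)"

text \<open>The brane labels are ordered \<open>p\<^sub>4 p\<^sub>1 p\<^sub>2 p\<^sub>3\<close>, as in the superscript of the correlator.\<close>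

definition trap_corr ::
  "complex \<Rightarrow> (nat \<Rightarrow> complex) \<Rightarrow> nat \<Rightarrow> nat \<Rightarrow> nat \<Rightarrow> nat \<Rightarrow> int \<Rightarrow> int \<Rightarrow> int \<Rightarrow> int \<Rightarrow> complex" where
  "trap_corr \<tau> u p4 p1 p2 p3 a b c d =
     trap_fun \<tau> a b c d (u p1 + u p2 + u p4) (u p1 - u p3)"

text \<open>
  The derivative with respect to the modulus of brane \<open>k\<close>. In the singular case, where
  \<open>v = u\<^bsub>p\<^sub>1\<^esub> - u\<^bsub>p\<^sub>3\<^esub>\<close> vanishes identically and one denominator is zero, \<open>v\<close> is first made an
  independent nonzero parameter, and \<open>v \<rightarrow> 0\<close> is taken after differentiation.
\<close>

definition d_trap_corr ::
  "nat \<Rightarrow> complex \<Rightarrow> (nat \<Rightarrow> complex) \<Rightarrow> nat \<Rightarrow> nat \<Rightarrow> nat \<Rightarrow> nat \<Rightarrow> int \<Rightarrow> int \<Rightarrow> int \<Rightarrow> int \<Rightarrow> complex" where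
  "d_trap_corr k \<tau> u p4 p1 p2 p3 a b c d =
     (if p1 = p3 \<and> rep3 (of_int (b - c)) = 3
      then Lim (at 0) (\<lambda>v. deriv (\<lambda>z. let w = u(k := z) in
             trap_fun \<tau> a b c d (w p1 + w p2 + w p4) v) (u k))
      else deriv (\<lambda>z. trap_corr \<tau> (u(k := z)) p4 p1 p2 p3 a b c d) (u k))"

end

(* Every correlator in the sum has v = 0 and depends on the moduli only through u_1 + u_2 + u_3.
   The selection rule kills all of them unless a = b. For a = b every first characteristic is 3, and
   the second characteristics b - c + 3/2 and c - b + 3/2 both run once through the residue classes
   modulo 3 as c does. So the two families of derivatives coincide up to a permutation of c. *)

theory Submission imports Defs begin

lemma rep3_add_3: "rep3 (x + 3) = rep3 x"
proof -
  have "(x + 3) / 3 = x / 3 + 1"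
    by simp
  then have "\<lceil>(x + 3) / 3\<rceil> = \<lceil>x / 3\<rceil> + 1"
    by linarith
  then show ?thesis
    by (simp add: rep3_def)
qed

text \<open>Since the interval is (0,3], a vanishing label difference is represented by 3; with
  \<open>p1 = p3\<close> this selects the singular branch of \<open>d_trap_corr\<close>.\<close>

lemma rep3_0: "rep3 0 = 3"
  by (simp add: rep3_def)

lemma sum_reflect_period_3:
  fixes G :: "int \<Rightarrow> 'a :: ab_group_add"
  assumes period: "\<And>m. G (m + 3) = G m" and b: "b \<in> {1, 2, 3}"
  shows "(\<Sum>c\<in>{1, 2, 3}. G (b - c) - G (c - b)) = 0"
proof -
  \<comment> \<open>All arguments lie between -2 and 2, so these two instances of periodicity fold
    them into {0, 1, 2}.\<close>
  have "G (-1) = G 2" "G (-2) = G 1"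
    using period[of "-1"] period[of "-2"] by simp_all
  then show ?thesis
    using b by auto
qed

lemma distinct_of_perm_3:
  assumes "{i, j, k} = {1, 2, 3 :: nat}"
  shows "i \<noteq> j" "i \<noteq> k" "j \<noteq> k"
proof -
  have "card {i, j, k} = 3"
    by (simp add: assms)
  then show "i \<noteq> j" "i \<noteq> k" "j \<noteq> k"
    by (auto simp: card_insert_if split: if_splits)
qed

text \<open>The common normal form of both families of derivatives: \<open>s\<close> collects the
  two moduli held fixed, \<open>x\<close> is the differentiated one, and \<open>m\<close> is the
  label difference in the second characteristic. Both families reduce to this same
  \<open>Lim\<close> expression, so the limit is never evaluated.\<close>

definition d_Theta_sing :: "complex \<Rightarrow> complex \<Rightarrow> complex \<Rightarrow> int \<Rightarrow> complex" where
  "d_Theta_sing \<tau> s x m =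
     Lim (at 0) (\<lambda>v. deriv (\<lambda>z. Theta_trap 3 (rep3 (of_int m + 3/2)) (3 * \<tau>) (3 * (s + z)) (3 * v)) x)"

lemma d_Theta_sing_period: "d_Theta_sing \<tau> s x (m + 3) = d_Theta_sing \<tau> s x m"
  using rep3_add_3[of "of_int m + 3/2"] by (simp add: d_Theta_sing_def add.commute add.left_commute)

lemma d_trap_corr_eq_0:
  assumes "(a + b) mod 3 \<noteq> (c + d) mod 3"
  shows "d_trap_corr k \<tau> u p4 p1 p2 p3 a b c d = 0"
proof -
  \<comment> \<open>\<open>Lim\<close> is a choice operator, so even the limit of the zero function
    in the singular branch has to be computed.\<close>
  have "Lim (at (0::complex)) (\<lambda>v. 0::complex) = 0"
    by (rule tendsto_Lim) simp_all
  with assms show ?thesis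
    by (simp add: d_trap_corr_def trap_corr_def trap_fun_def delta3_def)
qed

lemma d_trap_corr_p2:
  assumes "i \<noteq> k" "j \<noteq> k"
  shows "d_trap_corr k \<tau> u i j k j a c c a = d_Theta_sing \<tau> (u i + u j) (u k) (a - c)"
proof -
  \<comment> \<open>This reorders the sum inside \<open>deriv\<close>; the pattern survives only
    while 3 is not distributed over it, hence the deleted
    \<open>distrib_left_numeral\<close>.\<close>
  have sum: "u j + z + u i = u i + u j + z" for z
    by simp
  have "(a + c) mod 3 = (c + a) mod 3"
    by (simp add: add.commute)
  then show ?thesis
    using assms
    by (simp add: sum d_trap_corr_def trap_fun_def delta3_def rep3_0 d_Theta_sing_def del: distrib_left_numeral)
qed

lemma d_trap_corr_p4:
  assumes "i \<noteq> k" "j \<noteq> k"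
  shows "d_trap_corr k \<tau> u k i j i c a a c = d_Theta_sing \<tau> (u i + u j) (u k) (c - a)"
  using assms by (simp add: d_trap_corr_def trap_fun_def delta3_def rep3_0 d_Theta_sing_def add.commute)

lemma d_trap_corr_sum_eq_0:
  assumes "i \<noteq> k" "j \<noteq> k" "a \<in> {1, 2, 3}" "b \<in> {1, 2, 3}"
  shows "(\<Sum>c\<in>{1, 2, 3}. d_trap_corr k \<tau> u i j k j a c c b - d_trap_corr k \<tau> u k i j i c a b c) = 0"
proof (cases "a = b")
  case True
  with assms show ?thesis
    using sum_reflect_period_3[of "d_Theta_sing \<tau> (u i + u j) (u k)" b, OF d_Theta_sing_period]
    by (simp only: d_trap_corr_p2 d_trap_corr_p4 not_False_eq_True)
next
  case False
  then have "a mod 3 \<noteq> b mod 3"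
    using assms(3,4) by auto
  then have "(a + c) mod 3 \<noteq> (c + b) mod 3" "(c + a) mod 3 \<noteq> (b + c) mod 3" for c
    by (simp_all add: mod_eq_dvd_iff)
  then show ?thesis
    by (simp only: d_trap_corr_eq_0 not_False_eq_True) simp
qed

theorem mainTheorem4:
  shows
    "(\<forall>(\<tau>::complex) (u :: nat \<Rightarrow> complex) (i::nat) (j::nat) (k::nat) (a::int) (b::int).
        Im \<tau> > 0 \<longrightarrow> {i, j, k} = {1, 2, 3} \<longrightarrow> a \<in> {1, 2, 3} \<longrightarrow> b \<in> {1, 2, 3} \<longrightarrow>
        (\<Sum>c\<in>{1, 2, 3}. d_trap_corr k \<tau> u i j k j a c c b - d_trap_corr k \<tau> u k i j i c a b c) = 0)
   \<and> (\<forall>A :: nat \<Rightarrow> nat \<Rightarrow> complex \<Rightarrow> complex \<Rightarrow> complex \<Rightarrow> complex.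
        (\<forall>i\<in>{1, 2, 3}. \<forall>k\<in>{1, 2, 3}. \<forall>\<tau> x y. i \<noteq> k \<longrightarrow> Im \<tau> > 0 \<longrightarrow> A i k \<tau> x y = A k i \<tau> y x) \<longrightarrow>
        (\<forall>(\<tau>::complex) (u :: nat \<Rightarrow> complex) (i::nat) (j::nat) (k::nat) (a::int) (b::int).
           Im \<tau> > 0 \<longrightarrow> {i, j, k} = {1, 2, 3} \<longrightarrow> a \<in> {1, 2, 3} \<longrightarrow> b \<in> {1, 2, 3} \<longrightarrow>
           (if a = b then 1 else 0) * (A i k \<tau> (u i) (u k) - A j k \<tau> (u j) (u k)) =
           1 / (6 * of_real pi * \<i>) *
           (\<Sum>c\<in>{1, 2, 3}. d_trap_corr k \<tau> u i j k j a c c b - d_trap_corr k \<tau> u k i j i c a b c)) \<longrightarrow>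
        (\<exists>f :: complex \<Rightarrow> complex. \<forall>\<tau> (u :: nat \<Rightarrow> complex). Im \<tau> > 0 \<longrightarrow>
           A 1 2 \<tau> (u 1) (u 2) = 1 / (6 * of_real pi * \<i>)\<^sup>2 * f \<tau> \<and>
           A 2 3 \<tau> (u 2) (u 3) = 1 / (6 * of_real pi * \<i>)\<^sup>2 * f \<tau> \<and>
           A 3 1 \<tau> (u 3) (u 1) = 1 / (6 * of_real pi * \<i>)\<^sup>2 * f \<tau>))"
proof (intro conjI allI impI, goal_cases)
  case (1 \<tau> u i j k a b)
  from 1 distinct_of_perm_3[of i j k] show ?case
    by (intro d_trap_corr_sum_eq_0)
next
  case (2 A)
  note sym = 2(1) and relation = 2(2)
  \<comment> \<open>The relation at a = b = 1 has vanishing right-hand side. The three moduli can be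
    prescribed independently, so x and y are unrelated.\<close>
  have eq: "A i k \<tau> x z = A j k \<tau> y z"
    if \<tau>: "Im \<tau> > 0" and perm: "{i, j, k} = {1, 2, 3}" for i j k \<tau> x y z
  proof -
    have ne: "i \<noteq> j" "i \<noteq> k" "j \<noteq> k"
      using distinct_of_perm_3[OF perm] by auto
    then show ?thesis
      using relation[rule_format, OF \<tau> perm, of 1 1 "(\<lambda>_. z)(i := x, j := y)"]
        d_trap_corr_sum_eq_0[of i k j 1 1 \<tau> "(\<lambda>_. z)(i := x, j := y)"] by simp
  qed
  show ?case
  \<comment> \<open>The square cancels the prefactor; the base point (0, 0) is arbitrary because the
    correlator turns out to be constant in the moduli.\<close>
  proof (intro exI[of _ "\<lambda>\<tau>. (6 * of_real pi * \<i>)\<^sup>2 * A 1 2 \<tau> 0 0"] allI impI)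
    fix \<tau> :: complex and u :: "nat \<Rightarrow> complex"
    assume \<tau>: "Im \<tau> > 0"
    have A32: "A 3 2 \<tau> x y = A 1 2 \<tau> x' y" for x x' y
      by (rule eq[OF \<tau>]) auto
    have A31: "A 3 1 \<tau> x y = A 2 1 \<tau> x' y" for x x' y
      by (rule eq[OF \<tau>]) auto
    have A12: "A 1 2 \<tau> x y = A 2 1 \<tau> y x" for x y
      by (rule sym[rule_format, OF _ _ _ \<tau>]) simp_all
    have A23: "A 2 3 \<tau> x y = A 3 2 \<tau> y x" for x y
      by (rule sym[rule_format, OF _ _ _ \<tau>]) simp_all
    \<comment> \<open>Passing through \<open>A 3 2\<close> and back frees the first argument;
      symmetry followed by passing through \<open>A 3 1\<close> frees the second.\<close>
    have const: "A 1 2 \<tau> x y = A 1 2 \<tau> 0 0" for x y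
      by (metis A32 A31 A12)
    have "A 2 3 \<tau> x y = A 1 2 \<tau> 0 0" "A 3 1 \<tau> x y = A 1 2 \<tau> 0 0" for x y
      using A23 A32 A31 A12 const by metis+
    with const[of "u 1" "u 2"]
    show "A 1 2 \<tau> (u 1) (u 2) = 1 / (6 * of_real pi * \<i>)\<^sup>2 * ((6 * of_real pi * \<i>)\<^sup>2 * A 1 2 \<tau> 0 0) \<and>
          A 2 3 \<tau> (u 2) (u 3) = 1 / (6 * of_real pi * \<i>)\<^sup>2 * ((6 * of_real pi * \<i>)\<^sup>2 * A 1 2 \<tau> 0 0) \<and>
          A 3 1 \<tau> (u 3) (u 1) = 1 / (6 * of_real pi * \<i>)\<^sup>2 * ((6 * of_real pi * \<i>)\<^sup>2 * A 1 2 \<tau> 0 0)"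
      by simp
  qed
qed

end
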